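(* Let $G$ be a finite group with no maximal involutions, and let $\Gamma_G$ be its power graph. (i) If $G$ is cyclic, then $\mathrm{rc}(\Gamma_G)=1$ if $|G|$ is a prime power, and $\mathrm{rc}(\Gamma_G)=2$ otherwise. (ii) If $G$ is noncyclic, then $\mathrm{rc}(\Gamma_G)\in\{2,3\}$.
   Context: For a finite group $G$ with identity $e$, the power graph $\Gamma_G$ is the undirected graph with vertex set $G$ in which two distinct elements are adjacent if one is a power of the other. An involution is an element of order $2$. An involution $x$ is maximal if the only cyclic subgroup of $G$ containing $x$ is $\langle x\rangle$. For a connected graph $\Gamma$, an edge coloring $\zeta:E(\Gamma)\to\{1,\dots,k\}$ (adjacent edges may receive the same color) is a rainbow $k$-coloring if every pair of vertices is joined by a path whose edges have pairwise distinct colors; the rainbow connection number $\mathrm{rc}(\Gamma)$ is the minimum $k$ for which a rainbow $k$-coloring exists. *)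

theory Defs
  imports
    "HOL-Algebra.Elementary_Groups"
    "HOL-Algebra.Multiplicative_Group"
    "HOL-Computational_Algebra.Primes"
    "Graph_Theory.Graph_Theory"
begin

section \<open>Power graphs\<close>

text \<open>
  A simple undirected graph is a \<^locale>\<open>pair_graph\<close>: a finite, loop-free digraph
  without parallel arcs whose arc relation is symmetric.
\<close>

definition power_graph :: "('a, 'b) monoid_scheme \<Rightarrow> 'a pair_pre_digraph" where
  "power_graph G =
     \<lparr> pverts = carrier G,
       parcs = {(x, y). x \<in> carrier G \<and> y \<in> carrier G \<and> x \<noteq> y \<and>
                  ((\<exists>n::nat. x = y [^]\<^bsub>G\<^esub> n) \<or> (\<exists>n::nat. y = x [^]\<^bsub>G\<^esub> n))} \<rparr>"

lemma pair_graph_power_graph: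
  assumes "finite (carrier G)"
  shows "pair_graph (power_graph G)"
proof
  show "finite (parcs (power_graph G))"
    by (rule finite_subset[of _ "carrier G \<times> carrier G"])
       (use assms in \<open>auto simp: power_graph_def\<close>)
  show "symmetric (with_proj (power_graph G))"
    by (auto simp: symmetric_def power_graph_def intro!: symI)
qed (use assms in \<open>auto simp: power_graph_def\<close>)


section \<open>Maximal involutions\<close>

definition involution :: "('a, 'b) monoid_scheme \<Rightarrow> 'a \<Rightarrow> bool" where
  "involution G x \<longleftrightarrow> x \<in> carrier G \<and> group.ord G x = 2"

definition maximal_involution :: "('a, 'b) monoid_scheme \<Rightarrow> 'a \<Rightarrow> bool" where
  "maximal_involution G x \<longleftrightarrow> involution G x \<and>
     (\<forall>H. subgroup H G \<and> cyclic_group (G\<lparr>carrier := H\<rparr>) \<and> x \<in> H \<longrightarrow> H = generate G {x})"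


section \<open>Rainbow connection number\<close>

text \<open>
  Colors are attached to undirected edges, i.e. to the two-element sets \<open>{u, v}\<close>, so that
  the two arcs \<open>(u, v)\<close> and \<open>(v, u)\<close> always share one color.
\<close>

definition uedges :: "'a pair_pre_digraph \<Rightarrow> 'a set set" where
  "uedges \<Gamma> = {{u, v} | u v. (u, v) \<in> parcs \<Gamma>}"

definition rainbow_path :: "'a pair_pre_digraph \<Rightarrow> ('a set \<Rightarrow> nat) \<Rightarrow> 'a list \<Rightarrow> bool" where
  "rainbow_path \<Gamma> \<zeta> p \<longleftrightarrow>
     vpath p (with_proj \<Gamma>) \<and> distinct (map (\<lambda>(u, v). \<zeta> {u, v}) (vwalk_arcs p))"

definition rainbow_coloring :: "'a pair_pre_digraph \<Rightarrow> nat \<Rightarrow> ('a set \<Rightarrow> nat) \<Rightarrow> bool" where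
  "rainbow_coloring \<Gamma> k \<zeta> \<longleftrightarrow> \<zeta> \<in> uedges \<Gamma> \<rightarrow> {1..k} \<and>
     (\<forall>u \<in> pverts \<Gamma>. \<forall>v \<in> pverts \<Gamma>. \<exists>p. rainbow_path \<Gamma> \<zeta> p \<and> hd p = u \<and> last p = v)"

text \<open>
  The number of colors is a positive integer, so a one-vertex graph (like every other complete
  graph) has rainbow connection number 1. For a graph that is not connected there is no rainbow
  coloring and the value is unspecified.
\<close>

definition rainbow_connection_number :: "'a pair_pre_digraph \<Rightarrow> nat" where
  "rainbow_connection_number \<Gamma> = (LEAST k. k > 0 \<and> (\<exists>\<zeta>. rainbow_coloring \<Gamma> k \<zeta>))"

end

(*
  Every vertex is adjacent to the identity e, so a nonadjacent pair u, v can use the path u, e, v as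
  soon as the spokes {e, u} and {e, v} have distinct colors. Without maximal involutions the spokes
  can be 2-colored such that each u has a neighbour u' whose spoke has the other color: color x and
  its inverse differently, and for an involution take one of the two generators h, h^-1 of a larger
  cyclic subgroup. With color 3 on the remaining edges, u, u', e, v is rainbow if u, e, v is not.

  In a cyclic group of order n, vertices are adjacent iff their orders are comparable under
  divisibility, and the phi(n) generators are universal vertices as well. Since
  d(n) <= 2^(phi(n) + 1), elements of distinct orders can be given distinct color patterns on
  their edges to the universal vertices.
*)
theory Submission
  imports Defs "HOL-Number_Theory.Totient"
begin

section \<open>The number of divisors and the totient\<close>

text \<open>A divisor of a product splits into divisors of the factors, and those of
  \<open>p ^ a\<close> are the a + 1 powers of p. Hence the pairs (i, d) map onto a superset of the
  divisors, which suffices for an upper bound.\<close>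

lemma card_divisors_prime_power_mult_le:
  fixes p :: nat
  assumes "prime p" "m > 0"
  shows "card {d. d dvd p ^ a * m} \<le> Suc a * card {d. d dvd m}"
proof -
  have "{d. d dvd p ^ a * m} \<subseteq> (\<lambda>(i, d). p ^ i * d) ` ({..a} \<times> {d. d dvd m})"
  proof
    fix d assume "d \<in> {d. d dvd p ^ a * m}"
    then obtain b c where "d = b * c" "b dvd p ^ a" "c dvd m"
      using division_decomp by blast
    moreover from this obtain i where "i \<le> a" "b = p ^ i"
      using divides_primepow_nat[OF assms(1)] by blast
    ultimately show "d \<in> (\<lambda>(i, d). p ^ i * d) ` ({..a} \<times> {d. d dvd m})"
      by force
  qed
  then have "card {d. d dvd p ^ a * m} \<le> card ({..a} \<times> {d. d dvd m})"
    using assms by (intro surj_card_le) auto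
  then show ?thesis
    by (simp add: card_cartesian_product)
qed

lemma Suc_le_two_power: "Suc a \<le> 2 ^ a"
  using less_exp[of a] by (simp only: Suc_le_eq)

text \<open>Splitting off the full power p^a of a prime leaves a smaller m, and by induction d(n) <=
  (a + 1) d(m) <= 2^(a + phi(m)). It remains to see a + phi(m) <= phi(p^a) phi(m). As p is odd,
  phi(p^a) = p^(a-1) (p - 1) >= 2a, and 2at >= a + t for positive a and t.\<close>

lemma card_divisors_le_odd:
  fixes n :: nat
  assumes "odd n"
  shows "card {d. d dvd n} \<le> 2 ^ totient n"
  using assms
proof (induction n rule: less_induct)
  case (less n)
  show ?case
  proof (cases "n = 1")
    case True
    then show ?thesis by simp
  next
    case False
    then obtain p where p: "prime p" "p dvd n"
      using prime_factor_nat by blast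
    have "n \<noteq> 0" using less.prems by (cases n) auto
    then obtain m where m: "n = p ^ multiplicity p n * m" "\<not> p dvd m"
      using multiplicity_decompose'[of n p] p by (metis not_prime_unit)
    define a where "a = multiplicity p n"
    have n: "n = p ^ a * m" using m by (simp add: a_def)
    have a: "a > 0"
      using p \<open>n \<noteq> 0\<close> by (simp add: a_def prime_multiplicity_gt_zero_iff)
    have m0: "m > 0" using n \<open>n \<noteq> 0\<close> by (cases m) auto
    have "odd p" using p less.prems by (metis dvd_trans)
    then have p3: "p \<ge> 3" using prime_ge_2_nat[OF p(1)] by (cases "p = 2") auto
    have "p ^ a > 1" using p3 a by (intro one_less_power) auto
    then have "m < n" using n m0 by simp
    moreover have "odd m" using less.prems n by simp
    ultimately have IH: "card {d. d dvd m} \<le> 2 ^ totient m"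
      using less.IH by blast
    have "a \<le> p ^ (a - 1)"
    proof -
      have "Suc (a - 1) \<le> 2 ^ (a - 1)" by (rule Suc_le_two_power)
      also have "\<dots> \<le> p ^ (a - 1)" using p3 by (intro power_mono) auto
      finally show ?thesis using a by simp
    qed
    moreover have "2 \<le> p - 1" using p3 by simp
    ultimately have "a * 2 \<le> totient (p ^ a)"
      unfolding totient_prime_power[OF p(1) a] by (rule mult_le_mono)
    moreover have "coprime (p ^ a) m"
      using p m(2) by (simp add: prime_imp_coprime)
    ultimately have "a * 2 * totient m \<le> totient n"
      unfolding n by (simp add: totient_mult_coprime)
    moreover have "a + totient m \<le> a * 2 * totient m"
    proof -
      obtain a' t where "a = Suc a'" "totient m = Suc t"
        using a m0 by (metis gr0_implies_Suc totient_gt_0_iff)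
      then show ?thesis by simp
    qed
    ultimately have t: "a + totient m \<le> totient n" by simp
    have "card {d. d dvd n} \<le> Suc a * card {d. d dvd m}"
      unfolding n by (rule card_divisors_prime_power_mult_le[OF p(1) m0])
    also have "\<dots> \<le> 2 ^ a * 2 ^ totient m"
      by (intro mult_le_mono Suc_le_two_power IH)
    also have "\<dots> \<le> 2 ^ totient n"
      using t by (simp flip: power_add)
    finally show ?thesis .
  qed
qed

text \<open>The right-hand side counts the subsets of the identity together with the generators of a
  nontrivial cyclic group of order n. Splitting off the power of 2 gives only phi(2^a) >= a for a >
  0, without the factor 2 of the odd primes; the extra 1 in the exponent makes up for this.\<close>

lemma card_divisors_le:
  fixes n :: nat
  assumes "n > 0"
  shows "card {d. d dvd n} \<le> 2 ^ Suc (totient n)"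
proof -
  obtain m where m: "n = 2 ^ multiplicity 2 n * m" "odd m"
    using multiplicity_decompose'[of n 2] assms by auto
  define a where "a = multiplicity 2 n"
  have n: "n = 2 ^ a * m" using m by (simp add: a_def)
  have m0: "m > 0" using n assms by (cases m) auto
  have t: "a + totient m \<le> Suc (totient n)"
  proof (cases "a = 0")
    case True
    then show ?thesis using n by simp
  next
    case False
    have "coprime (2 ^ a) m" using m(2) by simp
    then have "totient n = 2 ^ (a - 1) * totient m"
      unfolding n using False by (simp add: totient_mult_coprime totient_prime_power)
    moreover have "a \<le> 2 ^ (a - 1)" using Suc_le_two_power[of "a - 1"] False by simp
    ultimately have "a * totient m \<le> totient n" by simp
    \<comment> \<open>This is (a - 1)(t - 1) >= 0 for t = \<open>totient m\<close>, written with
      successors to stay within the naturals.\<close>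
    moreover have "a + totient m \<le> Suc (a * totient m)"
    proof -
      obtain a' t where "a = Suc a'" "totient m = Suc t"
        using False m0 by (metis gr0_implies_Suc neq0_conv totient_gt_0_iff)
      then show ?thesis by simp
    qed
    ultimately show ?thesis by simp
  qed
  have "card {d. d dvd n} \<le> Suc a * card {d. d dvd m}"
    unfolding n using m0 by (intro card_divisors_prime_power_mult_le) auto
  also have "\<dots> \<le> 2 ^ a * 2 ^ totient m"
    by (intro mult_le_mono Suc_le_two_power card_divisors_le_odd m)
  also have "\<dots> \<le> 2 ^ Suc (totient n)"
    using t by (simp flip: power_add power_Suc)
  finally show ?thesis .
qed

lemma not_prime_power_two_primes:
  fixes n :: nat
  assumes "n > 0" "\<not> (\<exists>p m. prime p \<and> n = p ^ m)"
  obtains p q where "prime p" "prime q" "p \<noteq> q" "p dvd n" "q dvd n"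
proof -
  \<comment> \<open>The exponent 0 is allowed, so 1 counts as a prime power.\<close>
  have "n \<noteq> 1" using assms(2) two_is_prime_nat by (metis power_0)
  then obtain p where p: "prime p" "p dvd n"
    using prime_factor_nat by blast
  obtain m where m: "n = p ^ multiplicity p n * m" "\<not> p dvd m"
    using multiplicity_decompose'[of n p] p assms(1) by (metis not_prime_unit less_numeral_extra(3))
  have "m \<noteq> 1" using m(1) p(1) assms(2) by (metis mult_1_right)
  then obtain q where "prime q" "q dvd m"
    using prime_factor_nat by blast
  with p m that show ?thesis by (metis dvd_mult)
qed


section \<open>Rainbow colorings\<close>

lemma rainbow_path_singleton:
  "u \<in> pverts \<Gamma> \<Longrightarrow> rainbow_path \<Gamma> \<zeta> [u]"
  by (auto simp: rainbow_path_def vpath_def vwalk_def)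

lemma rainbow_path_edge:
  assumes "u \<in> pverts \<Gamma>" "v \<in> pverts \<Gamma>" "(u, v) \<in> parcs \<Gamma>" "u \<noteq> v"
  shows "rainbow_path \<Gamma> \<zeta> [u, v]"
  using assms by (auto simp: rainbow_path_def vpath_def vwalk_def)

lemma rainbow_path_two_edges:
  assumes "u \<in> pverts \<Gamma>" "w \<in> pverts \<Gamma>" "v \<in> pverts \<Gamma>"
    and "(u, w) \<in> parcs \<Gamma>" "(w, v) \<in> parcs \<Gamma>" "distinct [u, w, v]"
    and "\<zeta> {u, w} \<noteq> \<zeta> {w, v}"
  shows "rainbow_path \<Gamma> \<zeta> [u, w, v]"
  using assms by (auto simp: rainbow_path_def vpath_def vwalk_def)

lemma rainbow_path_three_edges:
  assumes "u \<in> pverts \<Gamma>" "w \<in> pverts \<Gamma>" "x \<in> pverts \<Gamma>" "v \<in> pverts \<Gamma>"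
    and "(u, w) \<in> parcs \<Gamma>" "(w, x) \<in> parcs \<Gamma>" "(x, v) \<in> parcs \<Gamma>" "distinct [u, w, x, v]"
    and "distinct [\<zeta> {u, w}, \<zeta> {w, x}, \<zeta> {x, v}]"
  shows "rainbow_path \<Gamma> \<zeta> [u, w, x, v]"
  using assms by (auto simp: rainbow_path_def vpath_def vwalk_def)

text \<open>Paths with at most one edge are rainbow under every coloring, so only distinct
  nonadjacent pairs need an argument.\<close>

lemma rainbow_coloringI:
  assumes "\<And>u v. (u, v) \<in> parcs \<Gamma> \<Longrightarrow> \<zeta> {u, v} \<in> {1..k}"
    and "\<And>u v. u \<in> pverts \<Gamma> \<Longrightarrow> v \<in> pverts \<Gamma> \<Longrightarrow> u \<noteq> v \<Longrightarrow> (u, v) \<notin> parcs \<Gamma> \<Longrightarrow>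
      \<exists>p. rainbow_path \<Gamma> \<zeta> p \<and> hd p = u \<and> last p = v"
  shows "rainbow_coloring \<Gamma> k \<zeta>"
proof -
  have "\<exists>p. rainbow_path \<Gamma> \<zeta> p \<and> hd p = u \<and> last p = v"
    if uv: "u \<in> pverts \<Gamma>" "v \<in> pverts \<Gamma>" for u v
  proof (cases "u = v")
    case True
    then show ?thesis using rainbow_path_singleton[OF uv(1)] by (intro exI[of _ "[u]"]) simp
  next
    case neq: False
    show ?thesis
    proof (cases "(u, v) \<in> parcs \<Gamma>")
      case True
      then show ?thesis using rainbow_path_edge[OF uv] neq by (intro exI[of _ "[u, v]"]) simp
    next
      case False
      then show ?thesis using assms(2) uv neq by blast
    qed
  qed
  moreover have "\<zeta> \<in> uedges \<Gamma> \<rightarrow> {1..k}"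
    using assms(1) unfolding uedges_def by blast
  ultimately show ?thesis by (simp add: rainbow_coloring_def)
qed

section \<open>Bounds on the rainbow connection number\<close>

text \<open>With at most one color, the first two edges of a longer path would already share a
  color, so a rainbow path between distinct vertices is a single edge.\<close>

lemma rainbow_coloring_less_2_imp_complete:
  assumes "rainbow_coloring \<Gamma> k \<zeta>" "k < 2" "u \<in> pverts \<Gamma>" "v \<in> pverts \<Gamma>" "u \<noteq> v"
  shows "(u, v) \<in> parcs \<Gamma>"
proof -
  obtain p where p: "rainbow_path \<Gamma> \<zeta> p" "hd p = u" "last p = v"
    using assms unfolding rainbow_coloring_def by blast
  have arcs: "set (vwalk_arcs p) \<subseteq> parcs \<Gamma>" "p \<noteq> []"
    using p(1) by (auto simp: rainbow_path_def vpath_def vwalk_def)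
  have one: "\<zeta> {x, y} = 1" if "(x, y) \<in> parcs \<Gamma>" for x y
  proof -
    have "{x, y} \<in> uedges \<Gamma>" using that by (auto simp: uedges_def)
    then have "\<zeta> {x, y} \<in> {1..k}"
      using assms(1) unfolding rainbow_coloring_def by blast
    then show ?thesis using assms(2) by simp
  qed
  obtain x q where q: "p = x # q" using arcs(2) by (cases p) auto
  obtain y r where r: "q = y # r" using p(2,3) q assms(5) by (cases q) auto
  show ?thesis
  proof (cases r)
    case Nil
    then show ?thesis using arcs p q r by simp
  next
    case (Cons z s)
    then have "\<zeta> {x, y} = 1" "\<zeta> {y, z} = 1" using arcs q r one by auto
    then show ?thesis using p(1) q r Cons by (simp add: rainbow_path_def)
  qed
qed

lemma rainbow_connection_number_le:
  "k > 0 \<Longrightarrow> rainbow_coloring \<Gamma> k \<zeta> \<Longrightarrow> rainbow_connection_number \<Gamma> \<le> k"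
  unfolding rainbow_connection_number_def by (rule Least_le) blast

text \<open>The \<open>LEAST\<close> in the definition is known to be attained only once some number
  of colors works; the given coloring supplies such a number.\<close>

lemma rainbow_coloring_rainbow_connection_number:
  assumes "k > 0" "rainbow_coloring \<Gamma> k \<zeta>"
  shows "rainbow_connection_number \<Gamma> > 0"
    and "\<exists>\<zeta>. rainbow_coloring \<Gamma> (rainbow_connection_number \<Gamma>) \<zeta>"
  using LeastI[of "\<lambda>k. k > 0 \<and> (\<exists>\<zeta>. rainbow_coloring \<Gamma> k \<zeta>)" k] assms
  unfolding rainbow_connection_number_def by blast+

lemma rainbow_connection_number_ge_2:
  assumes "k > 0" "rainbow_coloring \<Gamma> k \<zeta>"
    and "u \<in> pverts \<Gamma>" "v \<in> pverts \<Gamma>" "u \<noteq> v" "(u, v) \<notin> parcs \<Gamma>"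
  shows "rainbow_connection_number \<Gamma> \<ge> 2"
  using rainbow_coloring_rainbow_connection_number(2)[OF assms(1,2)]
    rainbow_coloring_less_2_imp_complete assms(3-6) by (meson not_le)

lemma rainbow_connection_number_complete:
  assumes "\<And>u v. u \<in> pverts \<Gamma> \<Longrightarrow> v \<in> pverts \<Gamma> \<Longrightarrow> u \<noteq> v \<Longrightarrow> (u, v) \<in> parcs \<Gamma>"
  shows "rainbow_connection_number \<Gamma> = 1"
proof -
  have "rainbow_coloring \<Gamma> 1 (\<lambda>_. 1)"
    using assms by (intro rainbow_coloringI) auto
  then show ?thesis
    using rainbow_connection_number_le[of 1] rainbow_coloring_rainbow_connection_number(1)[of 1]
    by (metis One_nat_def Suc_leI le_antisym zero_less_one)
qed


section \<open>Power graphs of finite groups\<close>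

lemma pverts_power_graph [simp]: "pverts (power_graph G) = carrier G"
  by (simp add: power_graph_def)

lemma parcs_power_graph_sym: "(x, y) \<in> parcs (power_graph G) \<Longrightarrow> (y, x) \<in> parcs (power_graph G)"
  by (auto simp: power_graph_def)

section \<open>Cyclic subgroups, orders and adjacency in a finite group\<close>

locale finite_group = group +
  assumes finite_carrier [simp]: "finite (carrier G)"
begin

text \<open>In a finite group inverses are themselves powers with natural exponents. This matches
  \<open>power_graph\<close>, so adjacency becomes membership in a cyclic subgroup.\<close>

lemma generate_eq_powers:
  "x \<in> carrier G \<Longrightarrow> generate G {x} = range (\<lambda>n::nat. x [^] n)"
  using generate_pow_on_finite_carrier[OF finite_carrier] by auto

lemma parcs_power_graph_iff:
  assumes "x \<in> carrier G" "y \<in> carrier G"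
  shows "(x, y) \<in> parcs (power_graph G) \<longleftrightarrow>
    x \<noteq> y \<and> (x \<in> generate G {y} \<or> y \<in> generate G {x})"
  using assms by (auto simp: power_graph_def generate_eq_powers)

lemma finite_generate [simp]: "x \<in> carrier G \<Longrightarrow> finite (generate G {x})"
  by (rule finite_subset[OF generate_incl]) auto

lemma generate_mono_singleton:
  "x \<in> carrier G \<Longrightarrow> y \<in> generate G {x} \<Longrightarrow> generate G {y} \<subseteq> generate G {x}"
  by (intro generate_subgroup_incl generate_is_subgroup) auto

lemma ord_dvd_of_mem_generate:
  assumes "x \<in> carrier G" "y \<in> generate G {x}"
  shows "ord y dvd ord x"
proof -
  obtain n :: nat where "y = x [^] n" using assms generate_eq_powers by auto
  then have "y [^] ord x = \<one>"
    using assms(1) by (metis nat_pow_pow mult.commute nat_pow_one pow_ord_eq_1)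
  then show ?thesis
    using \<open>y = x [^] n\<close> assms(1) by (simp add: pow_eq_id)
qed

lemma cyclic_groupI:
  assumes "x \<in> carrier G" "generate G {x} = carrier G"
  shows "cyclic_group G"
  using assms generate_pow[of x] unfolding cyclic_group by (intro bexI[of _ x]) (auto simp: set_eq_iff image_iff)

lemma cyclic_groupE:
  assumes "cyclic_group G"
  obtains g where "g \<in> carrier G" "generate G {g} = carrier G" "ord g = order G"
proof -
  obtain g where g: "g \<in> carrier G" "carrier G = range (\<lambda>n::int. g [^] n)"
    using assms cyclic_group by auto
  then have "generate G {g} = carrier G"
    using generate_pow[of g] by auto
  then show thesis using that g generate_pow_card[of g] by (simp add: order_def)
qed

text \<open>An element x of maximal order generates the group: for y outside its span, adjacency
  puts x into the span of y, and then maximality of the order makes the two spans equal, a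
  contradiction.\<close>

lemma power_graph_complete_imp_cyclic:
  assumes "\<And>x y. x \<in> carrier G \<Longrightarrow> y \<in> carrier G \<Longrightarrow> x \<noteq> y \<Longrightarrow>
    (x, y) \<in> parcs (power_graph G)"
  shows "cyclic_group G"
proof -
  have "Max (ord ` carrier G) \<in> ord ` carrier G"
    using one_closed by (intro Max_in) auto
  then obtain x where x: "x \<in> carrier G" "ord x = Max (ord ` carrier G)" by auto
  have le: "ord y \<le> ord x" if "y \<in> carrier G" for y
    unfolding x(2) using that by (intro Max_ge) auto
  have "y \<in> generate G {x}" if y: "y \<in> carrier G" for y
  proof (rule ccontr)
    assume n: "y \<notin> generate G {x}"
    then have "x \<noteq> y" using generate.incl[of x "{x}"] by auto
    then have xy: "x \<in> generate G {y}"
      using assms[OF x(1) y] n parcs_power_graph_iff[OF x(1) y] by auto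
    then have "generate G {x} \<subseteq> generate G {y}"
      using generate_mono_singleton y by blast
    moreover have "card (generate G {y}) \<le> card (generate G {x})"
      using le[OF y] generate_pow_card x(1) y by simp
    ultimately have "generate G {x} = generate G {y}"
      using y by (intro card_seteq) auto
    then show False using n generate.incl[of y "{y}"] by auto
  qed
  then have "generate G {x} = carrier G"
    using generate_incl[of "{x}"] x(1) by auto
  then show ?thesis using cyclic_groupI x(1) by blast
qed

text \<open>
  The solutions of \<open>z\<^sup>d = \<one>\<close> with \<open>d = ord x\<close> all lie in the subgroup generated by
  \<open>g\<close> to the power \<open>n div d\<close>, which has only \<open>d\<close> elements.
\<close>
lemma cyclic_mem_generate:
  assumes "cyclic_group G" "x \<in> carrier G" "y \<in> carrier G" "ord y dvd ord x"
  shows "y \<in> generate G {x}"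
proof -
  obtain g where g: "g \<in> carrier G" "generate G {g} = carrier G" "ord g = order G"
    using cyclic_groupE[OF assms(1)] .
  define d where "d = ord x"
  have d: "d dvd order G" "d > 0"
    using assms(2) ord_dvd_group_order ord_ge_1[OF finite_carrier, of x] by (auto simp: d_def)
  then obtain k where k: "order G = d * k" by blast
  have "order G > 0" by (simp add: order_gt_0_iff_finite)
  then have k0: "k > 0" using k by (cases k) auto
  define h where "h = g [^] k"
  have h: "h \<in> carrier G" using g by (simp add: h_def)
  have "ord h = d"
    unfolding h_def using g k k0 by (subst ord_pow) auto
  have sol: "z \<in> generate G {h}" if z: "z \<in> carrier G" "ord z dvd d" for z
  proof -
    obtain i :: nat where i: "z = g [^] i"
      using z g generate_eq_powers[of g] by auto
    have "z [^] d = \<one>" using z by (simp add: pow_eq_id)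
    then have "order G dvd i * d"
      using g i by (simp add: nat_pow_pow pow_eq_id)
    then have "k dvd i" using k d by (simp add: mult.commute)
    then obtain j where "i = k * j" by blast
    then have "z = h [^] j" using g i by (simp add: h_def nat_pow_pow)
    then show ?thesis using generate_eq_powers[OF h] by auto
  qed
  have "x \<in> generate G {h}" using sol assms(2) by (simp add: d_def)
  then have "generate G {x} \<subseteq> generate G {h}"
    by (rule generate_mono_singleton[OF h])
  moreover have "card (generate G {h}) \<le> card (generate G {x})"
    using \<open>ord h = d\<close> generate_pow_card h assms(2) by (simp add: d_def)
  ultimately have "generate G {x} = generate G {h}"
    using h by (intro card_seteq) auto
  then show ?thesis using sol assms(3,4) by (simp add: d_def)
qed

section \<open>Cyclic groups: adjacency by orders, and two colors\<close>

lemma cyclic_parcs_power_graph_iff: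
  assumes "cyclic_group G" "x \<in> carrier G" "y \<in> carrier G"
  shows "(x, y) \<in> parcs (power_graph G) \<longleftrightarrow>
    x \<noteq> y \<and> (ord x dvd ord y \<or> ord y dvd ord x)"
  using assms parcs_power_graph_iff cyclic_mem_generate ord_dvd_of_mem_generate by metis

text \<open>The divisors of p^m form a chain under divisibility, so all orders are comparable and
  the graph is complete.\<close>

lemma cyclic_prime_power_rainbow_connection_number:
  assumes "cyclic_group G" "prime (p::nat)" "order G = p ^ m"
  shows "rainbow_connection_number (power_graph G) = 1"
proof (rule rainbow_connection_number_complete)
  fix u v assume uv: "u \<in> pverts (power_graph G)" "v \<in> pverts (power_graph G)" "u \<noteq> v"
  have "ord u dvd p ^ m" "ord v dvd p ^ m"
    using uv ord_dvd_group_order assms(3) by force+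
  then obtain i j where "ord u = p ^ i" "ord v = p ^ j"
    unfolding divides_primepow_nat[OF assms(2)] by blast
  then have "ord u dvd ord v \<or> ord v dvd ord u"
    using le_imp_power_dvd[of i j p] le_imp_power_dvd[of j i p] nat_le_linear[of i j] by metis
  then show "(u, v) \<in> parcs (power_graph G)"
    using uv cyclic_parcs_power_graph_iff[OF assms(1)] by simp
qed

text \<open>Two distinct primes dividing the group order occur as orders of elements, and neither
  divides the other.\<close>

lemma cyclic_not_complete:
  assumes "cyclic_group G" "\<not> (\<exists>(p::nat) m. prime p \<and> order G = p ^ m)"
  obtains u v where "u \<in> carrier G" "v \<in> carrier G" "u \<noteq> v" "(u, v) \<notin> parcs (power_graph G)"
proof -
  obtain g where g: "g \<in> carrier G" "generate G {g} = carrier G" "ord g = order G"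
    using cyclic_groupE[OF assms(1)] .
  have n: "order G > 0" by (simp add: order_gt_0_iff_finite)
  obtain p q where pq: "prime p" "prime q" "p \<noteq> q" "p dvd order G" "q dvd order G"
    using not_prime_power_two_primes[OF n assms(2)] .
  have ord: "ord (g [^] (order G div r)) = r" if "r dvd order G" for r
  proof -
    have "order G div r \<noteq> 0" "order G div r dvd ord g"
      using that n g(3) by (auto elim!: dvdE)
    then have "ord (g [^] (order G div r)) = ord g div (order G div r)"
      using g(1) by (intro ord_pow)
    then show ?thesis using that n g(3) by (auto elim!: dvdE)
  qed
  define u v where "u = g [^] (order G div p)" and "v = g [^] (order G div q)"
  have uv: "u \<in> carrier G" "v \<in> carrier G" "ord u = p" "ord v = q"
    using g ord pq by (auto simp: u_def v_def)
  moreover have "\<not> p dvd q" "\<not> q dvd p"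
    using pq primes_dvd_imp_eq by blast+
  moreover have "u \<noteq> v" using uv pq by auto
  ultimately show thesis
    using that[of u v] cyclic_parcs_power_graph_iff[OF assms(1)] by simp
qed

text \<open>The universal vertices in \<open>U\<close> serve as midpoints. An injection
  \<open>f\<close> assigns to each divisor of the group order a subset of \<open>U\<close>, and an
  element v outside \<open>U\<close> displays \<open>f (ord v)\<close> on its edges to
  \<open>U\<close>. Nonadjacent elements have distinct orders, hence distinct subsets, and any w in
  exactly one of these subsets is the midpoint of a rainbow path.\<close>

lemma cyclic_rainbow_coloring_2:
  assumes "cyclic_group G" "order G \<noteq> 1"
  shows "\<exists>\<zeta>. rainbow_coloring (power_graph G) 2 \<zeta>"
proof -
  obtain g where g: "g \<in> carrier G" "generate G {g} = carrier G" "ord g = order G"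
    using cyclic_groupE[OF assms(1)] .
  have n: "order G > 0" by (simp add: order_gt_0_iff_finite)
  define gens where "gens = (\<lambda>k. g [^] k) ` totatives (order G)"
  define U where "U = insert \<one> gens"
  have ord_gens: "w \<in> carrier G \<and> ord w = order G" if "w \<in> gens" for w
    using that g pow_ord_eq_ord_iff[OF finite_carrier g(1)]
    by (auto simp: gens_def totatives_def)
  \<comment> \<open>Totatives range over 1 to n, not 0 to n - 1, which calls for the version of
    injectivity on \<open>{1..ord g}\<close>.\<close>
  have "inj_on (\<lambda>k. g [^] k) (totatives (order G))"
    by (rule inj_on_subset[OF ord_inj'[OF g(1)]])
       (auto simp: g(3) totatives_def)
  then have "card gens = totient (order G)"
    by (simp add: gens_def card_image totient_def)
  \<comment> \<open>In the trivial group the identity would be the generator, and \<open>U\<close>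
    would be too small by one.\<close>
  moreover have "\<one> \<notin> gens" using ord_gens assms(2) ord_id by force
  ultimately have cardU: "card U = Suc (totient (order G))"
    by (simp add: U_def gens_def)
  have finU: "finite U" by (simp add: U_def gens_def)
  have U_carrier: "U \<subseteq> carrier G" using ord_gens by (auto simp: U_def)
  have U_adj: "(w, v) \<in> parcs (power_graph G)" if "w \<in> U" "v \<in> carrier G" "w \<noteq> v" for w v
  proof -
    have "ord w dvd ord v \<or> ord v dvd ord w"
      using that ord_gens ord_dvd_group_order by (auto simp: U_def)
    then show ?thesis
      using that U_carrier cyclic_parcs_power_graph_iff[OF assms(1)] by blast
  qed
  have "card {d. d dvd order G} \<le> card (Pow U)"
    using card_divisors_le[OF n] by (simp add: card_Pow finU cardU)
  then obtain f where f: "f ` {d. d dvd order G} \<subseteq> Pow U" "inj_on f {d. d dvd order G}"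
    using card_le_inj[of "{d. d dvd order G}" "Pow U"] finU n by auto
  \<comment> \<open>Edges with both ends in \<open>U\<close> or both outside get the default color
    2. On the others exactly one end lies in \<open>U\<close>, so the unordered pair determines the
    roles of v and w.\<close>
  define \<zeta> where "\<zeta> A =
    (if \<exists>v w. A = {v, w} \<and> v \<notin> U \<and> w \<in> U \<and> w \<in> f (ord v) then 1 else 2 :: nat)" for A
  have \<zeta>: "\<zeta> {v, w} = (if w \<in> f (ord v) then 1 else 2)" if "v \<notin> U" "w \<in> U" for v w
    using that by (auto simp: \<zeta>_def doubleton_eq_iff)
  have "rainbow_coloring (power_graph G) 2 \<zeta>"
  proof (rule rainbow_coloringI)
    fix u v assume uv: "u \<in> pverts (power_graph G)" "v \<in> pverts (power_graph G)" "u \<noteq> v"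
      "(u, v) \<notin> parcs (power_graph G)"
    have notU: "u \<notin> U" "v \<notin> U"
      using uv U_adj[of u v] U_adj[of v u] parcs_power_graph_sym[of v u G] by auto
    have dvd: "ord u dvd order G" "ord v dvd order G"
      using uv ord_dvd_group_order by auto
    have "ord u \<noteq> ord v"
      using uv cyclic_parcs_power_graph_iff[OF assms(1), of u v] by auto
    then have "f (ord u) \<noteq> f (ord v)" using f(2) dvd by (auto dest: inj_onD)
    moreover have "f (ord u) \<subseteq> U" "f (ord v) \<subseteq> U" using f(1) dvd by auto
    ultimately obtain w where w: "w \<in> U" "w \<in> f (ord u) \<longleftrightarrow> w \<notin> f (ord v)"
      by blast
    have "\<zeta> {u, w} \<noteq> \<zeta> {v, w}"
      unfolding \<zeta>[OF notU(1) w(1)] \<zeta>[OF notU(2) w(1)] using w(2) by simp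
    then have "\<zeta> {u, w} \<noteq> \<zeta> {w, v}" by (metis insert_commute)
    moreover have "(u, w) \<in> parcs (power_graph G)" "(w, v) \<in> parcs (power_graph G)"
      using U_adj[of w u] U_adj[of w v] uv w(1) notU parcs_power_graph_sym[of w u G] by auto
    ultimately have "rainbow_path (power_graph G) \<zeta> [u, w, v]"
      using uv w(1) notU U_carrier by (intro rainbow_path_two_edges) auto
    then show "\<exists>p. rainbow_path (power_graph G) \<zeta> p \<and> hd p = u \<and> last p = v"
      by (intro exI[of _ "[u, w, v]"]) simp
  qed (simp add: \<zeta>_def)
  then show ?thesis by blast
qed

lemma cyclic_not_prime_power_rainbow_connection_number:
  assumes "cyclic_group G" "\<not> (\<exists>(p::nat) m. prime p \<and> order G = p ^ m)"
  shows "rainbow_connection_number (power_graph G) = 2"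
proof -
  have "order G \<noteq> 1" using assms(2) two_is_prime_nat by (metis power_0)
  then obtain \<zeta> where \<zeta>: "rainbow_coloring (power_graph G) 2 \<zeta>"
    using cyclic_rainbow_coloring_2[OF assms(1)] by blast
  obtain u v where "u \<in> carrier G" "v \<in> carrier G" "u \<noteq> v" "(u, v) \<notin> parcs (power_graph G)"
    using cyclic_not_complete[OF assms] .
  then have "rainbow_connection_number (power_graph G) \<ge> 2"
    using \<zeta> by (intro rainbow_connection_number_ge_2[of 2 _ \<zeta> u v]) auto
  then show ?thesis
    using rainbow_connection_number_le[OF _ \<zeta>] by simp
qed

section \<open>Groups without maximal involutions: three colors\<close>

lemma inv_mem_generate: "x \<in> carrier G \<Longrightarrow> inv x \<in> generate G {x}"
  by (rule generate.inv) simp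

text \<open>Here h generates a cyclic subgroup containing x other than the span of x. If h were its
  own inverse, its powers would be just the identity and h, forcing x = h. The conclusion
  \<open>inv h \<noteq> h\<close> lets a coloring separate the two generators.\<close>

lemma nonmaximal_involution_mem_generate:
  assumes "involution G x" "\<not> maximal_involution G x"
  obtains h where "h \<in> carrier G" "x \<in> generate G {h}" "x \<noteq> h" "inv h \<noteq> h"
proof -
  have x: "x \<in> carrier G" "ord x = 2" using assms(1) by (auto simp: involution_def)
  then have x1: "x \<noteq> \<one>" by force
  obtain H where H: "subgroup H G" "cyclic_group (G\<lparr>carrier := H\<rparr>)" "x \<in> H" "H \<noteq> generate G {x}"
    using assms by (auto simp: maximal_involution_def)
  interpret H: group "G\<lparr>carrier := H\<rparr>"
    using H(1) by (rule subgroup_imp_group)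
  obtain h where h: "h \<in> H" "H = range (\<lambda>n::int. h [^]\<^bsub>G\<lparr>carrier := H\<rparr>\<^esub> n)"
    using H(2) H.cyclic_group by auto
  have hG: "h \<in> carrier G" by (rule subgroup.mem_carrier[OF H(1) h(1)])
  \<comment> \<open>Powers taken in the subgroup are turned into powers in \<open>G\<close>.\<close>
  have "H = range (\<lambda>n::int. h [^] n)"
    by (rule h(2)[unfolded int_pow_consistent[OF H(1) h(1), symmetric]])
  also have "\<dots> = generate G {h}" unfolding generate_pow[OF hG] by auto
  finally have H_eq: "H = generate G {h}" .
  have "x \<in> range (\<lambda>n::nat. h [^] n)"
    using H(3) unfolding H_eq generate_eq_powers[OF hG] .
  then obtain k :: nat where k: "x = h [^] k" by blast
  have "x \<noteq> h" using H(4) H_eq by auto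
  moreover have "inv h \<noteq> h"
  proof
    assume "inv h = h"
    then have hh: "h [^] (2::nat) = \<one>"
      using hG by (metis numeral_2_eq_2 nat_pow_Suc nat_pow_0 l_one r_inv)
    have "x = h [^] (2 * (k div 2) + k mod 2)" using k by simp
    also have "\<dots> = (h [^] (2::nat)) [^] (k div 2) \<otimes> h [^] (k mod 2)"
      using hG by (simp only: nat_pow_pow nat_pow_mult)
    also have "\<dots> = h [^] (k mod 2)" using hh hG by simp
    finally have "x = h [^] (k mod 2)" .
    then have "x = \<one> \<or> x = h"
      using hG by (cases "even k") (auto simp: odd_iff_mod_2_eq_one)
    then show False using x1 \<open>x \<noteq> h\<close> by blast
  qed
  ultimately show thesis using that hG H(3) H_eq by blast
qed

lemma involutionI:
  assumes "x \<in> carrier G" "x \<noteq> \<one>" "inv x = x"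
  shows "involution G x"
proof -
  have "x [^] (2::nat) = \<one>"
    using assms by (metis numeral_2_eq_2 nat_pow_Suc nat_pow_0 l_one r_inv)
  then have "ord x dvd 2" using assms(1) by (simp add: pow_eq_id)
  then have "ord x = 2"
    using assms ord_eq_1 two_is_prime_nat by (metis prime_nat_iff)
  then show ?thesis using assms(1) by (simp add: involution_def)
qed

text \<open>If x differs from its inverse, the inverse is the neighbour. Otherwise x is adjacent to
  both h and \<open>inv h\<close> for a suitable h; these have different colors, so at least one of
  them differs in color from x.\<close>

lemma no_maximal_involution_neighbour:
  assumes "\<not> (\<exists>x. maximal_involution G x)"
    and c: "\<And>x. x \<in> carrier G \<Longrightarrow> inv x \<noteq> x \<Longrightarrow> c (inv x) \<noteq> c x"
    and x: "x \<in> carrier G" "x \<noteq> \<one>"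
  obtains y where "y \<in> carrier G" "y \<noteq> \<one>" "(x, y) \<in> parcs (power_graph G)" "c y \<noteq> c x"
proof (cases "inv x = x")
  case False
  have "(x, inv x) \<in> parcs (power_graph G)"
    using x False inv_mem_generate by (subst parcs_power_graph_iff) auto
  moreover have "inv x \<noteq> \<one>" using x by (simp add: inv_eq_1_iff)
  ultimately show thesis using that[of "inv x"] c x False by auto
next
  case True
  obtain h where h: "h \<in> carrier G" "x \<in> generate G {h}" "x \<noteq> h" "inv h \<noteq> h"
    using nonmaximal_involution_mem_generate involutionI[OF x True] assms(1) by blast
  \<comment> \<open>If x = h^k, then \<open>inv x\<close> is the k-th power of \<open>inv h\<close>;
    as x is its own inverse, it lies in the span of \<open>inv h\<close>.\<close>
  have "inv x \<in> generate G {inv h}"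
  proof -
    obtain k :: nat where "x = h [^] k" using h generate_eq_powers by auto
    then have "inv x = (inv h) [^] k" using h(1) by (simp add: nat_pow_inv)
    then show ?thesis using h(1) by (auto simp: generate_eq_powers)
  qed
  then have "x \<in> generate G {inv h}" using True by simp
  moreover have "x \<noteq> inv h" using h True by force
  ultimately have adj: "(x, h) \<in> parcs (power_graph G)" "(x, inv h) \<in> parcs (power_graph G)"
    using h x by (auto simp: parcs_power_graph_iff)
  have ne: "h \<noteq> \<one>" "inv h \<noteq> \<one>" using h by (auto simp: inv_eq_1_iff)
  have "c h \<noteq> c x \<or> c (inv h) \<noteq> c x" using c[of h] h by auto
  then show thesis using that[of h] that[of "inv h"] adj ne h(1) inv_closed by blast
qed

lemma no_maximal_involution_rainbow_coloring_3:
  assumes "\<not> (\<exists>x. maximal_involution G x)"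
  shows "\<exists>\<zeta>. rainbow_coloring (power_graph G) 3 \<zeta>"
proof -
  \<comment> \<open>The choice depends only on the set {x, \<open>inv x\<close>}, so x and its
    inverse agree on the chosen element, and exactly one of them equals it when they differ.\<close>
  define c where "c x = (if (SOME y. y \<in> {x, inv x}) = x then 1 else 2 :: nat)" for x
  have c: "c (inv x) \<noteq> c x" if "x \<in> carrier G" "inv x \<noteq> x" for x
  proof -
    have "(SOME y. y \<in> {x, inv x}) \<in> {x, inv x}" by (rule someI[of _ x]) simp
    moreover have "{inv x, inv (inv x)} = {x, inv x}" using that by auto
    ultimately show ?thesis using that by (auto simp: c_def)
  qed
  have c12: "c x = 1 \<or> c x = 2" for x by (simp add: c_def)
  \<comment> \<open>A spoke gets the color \<open>c\<close> of its end other than the identity; all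
    remaining edges get color 3.\<close>
  define \<zeta> where "\<zeta> A = (if \<one> \<in> A then c (the_elem (A - {\<one>})) else 3)" for A
  have spoke: "\<zeta> {u, \<one>} = c u" "\<zeta> {\<one>, u} = c u" if "u \<noteq> \<one>" for u
    using that by (simp_all add: \<zeta>_def insert_Diff_if)
  have rim: "\<zeta> {u, v} = 3" if "u \<noteq> \<one>" "v \<noteq> \<one>" for u v
    using that by (simp add: \<zeta>_def)
  have one_adj: "(u, \<one>) \<in> parcs (power_graph G)" "(\<one>, u) \<in> parcs (power_graph G)"
    if "u \<in> carrier G" "u \<noteq> \<one>" for u
    using that generate.one by (auto simp: parcs_power_graph_iff)
  have "rainbow_coloring (power_graph G) 3 \<zeta>"
  proof (rule rainbow_coloringI)
    fix u v assume "(u, v) \<in> parcs (power_graph G)"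
    have "\<zeta> {u, v} \<in> {1, 2, 3}"
      using c12 by (auto simp: \<zeta>_def)
    then show "\<zeta> {u, v} \<in> {1..3}" by auto
  next
    fix u v assume uv: "u \<in> pverts (power_graph G)" "v \<in> pverts (power_graph G)" "u \<noteq> v"
      "(u, v) \<notin> parcs (power_graph G)"
    then have ne: "u \<noteq> \<one>" "v \<noteq> \<one>" using one_adj by auto
    show "\<exists>p. rainbow_path (power_graph G) \<zeta> p \<and> hd p = u \<and> last p = v"
    proof (cases "c u = c v")
      case False
      then have "\<zeta> {u, \<one>} \<noteq> \<zeta> {\<one>, v}"
        by (simp only: spoke[OF ne(1)] spoke[OF ne(2)] not_False_eq_True)
      then have "rainbow_path (power_graph G) \<zeta> [u, \<one>, v]"
        using uv ne one_adj[of u] one_adj[of v] by (intro rainbow_path_two_edges) auto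
      then show ?thesis by (intro exI[of _ "[u, \<one>, v]"]) simp
    next
      case True
      obtain y where y: "y \<in> carrier G" "y \<noteq> \<one>" "(u, y) \<in> parcs (power_graph G)" "c y \<noteq> c u"
        using no_maximal_involution_neighbour[where c = c and x = u, OF assms c] uv(1) ne(1)
        unfolding pverts_power_graph by blast
      \<comment> \<open>The vertex y differs from v because u is adjacent to y but not to v.\<close>
      have "distinct [u, y, \<one>, v]" using uv y ne by auto
      \<comment> \<open>The three colors are 3, \<open>c y\<close> and \<open>c v\<close>, where
        \<open>c v = c u\<close> differs from \<open>c y\<close> and \<open>c\<close> takes only the
        values 1 and 2.\<close>
      moreover have "distinct [\<zeta> {u, y}, \<zeta> {y, \<one>}, \<zeta> {\<one>, v}]"
        unfolding rim[OF ne(1) y(2)] spoke(1)[OF y(2)] spoke(2)[OF ne(2)]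
        using True y(4) c12[of y] c12[of v] by auto
      ultimately have "rainbow_path (power_graph G) \<zeta> [u, y, \<one>, v]"
        using uv(1,2) y(1,3) one_adj(1)[OF y(1,2)] one_adj(2)[of v] ne(2)
        by (intro rainbow_path_three_edges) simp_all
      then show ?thesis by (intro exI[of _ "[u, y, \<one>, v]"]) simp
    qed
  qed
  then show ?thesis by blast
qed

text \<open>The lower bound holds since a complete power graph would make the group cyclic; the
  upper bound is the coloring with three colors.\<close>

lemma noncyclic_rainbow_connection_number:
  assumes "\<not> (\<exists>x. maximal_involution G x)" "\<not> cyclic_group G"
  shows "rainbow_connection_number (power_graph G) \<in> {2, 3}"
proof -
  obtain \<zeta> where \<zeta>: "rainbow_coloring (power_graph G) 3 \<zeta>"
    using no_maximal_involution_rainbow_coloring_3[OF assms(1)] by blast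
  obtain u v where "u \<in> carrier G" "v \<in> carrier G" "u \<noteq> v" "(u, v) \<notin> parcs (power_graph G)"
    using power_graph_complete_imp_cyclic assms(2) by blast
  then have "rainbow_connection_number (power_graph G) \<ge> 2"
    using \<zeta> by (intro rainbow_connection_number_ge_2[of 3 _ \<zeta> u v]) auto
  moreover have "rainbow_connection_number (power_graph G) \<le> 3"
    using \<zeta> by (intro rainbow_connection_number_le) auto
  ultimately show ?thesis by auto
qed

end

theorem theorem3p1:
  fixes G :: "('a, 'b) monoid_scheme"
  assumes "group G"
    and "finite (carrier G)"
    and "\<not> (\<exists>x. maximal_involution G x)"
  shows "(cyclic_group G \<longrightarrow>
            ((\<exists>(p::nat) (m::nat). prime p \<and> order G = p ^ m) \<longrightarrow>
               rainbow_connection_number (power_graph G) = 1) \<and>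
            (\<not> (\<exists>(p::nat) (m::nat). prime p \<and> order G = p ^ m) \<longrightarrow>
               rainbow_connection_number (power_graph G) = 2)) \<and>
         (\<not> cyclic_group G \<longrightarrow> rainbow_connection_number (power_graph G) \<in> {2, 3})"
proof -
  interpret finite_group G
    using assms by (intro finite_group.intro finite_group_axioms.intro)
  show ?thesis
    using cyclic_prime_power_rainbow_connection_number noncyclic_rainbow_connection_number
      cyclic_not_prime_power_rainbow_connection_number assms(3) by blast
qed

end
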